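(* Let $\mathbf{x}=(x_1,\dots,x_5)$ and $\mathbf{y}=(y_1,\dots,y_4)$ be real variables, and let $P$ be the $5\times 4$ biquadratic form \[ \begin{aligned} P(\mathbf{x},\mathbf{y}) =&\; x_1^2 y_1^2 + x_1^2 y_2^2 + x_1^2 y_3^2 + x_2^2 y_1^2 + x_2^2 y_4^2 + x_3^2 y_2^2 + x_3^2 y_4^2 \\ &+ x_4^2 y_3^2 + x_4^2 y_4^2 + x_5^2 y_1^2 + (x_2 y_3 + x_5 y_4)^2 + (x_4 + x_5)^2 y_2^2 . \end{aligned} \] Then $\operatorname{sos}(P)=12$.
   Context: An $m\times n$ biquadratic form is a polynomial $P(\mathbf{x},\mathbf{y})=\sum_{i=1}^m\sum_{j=1}^n\sum_{k=1}^m\sum_{l=1}^n a_{ijkl}\,x_i x_k y_j y_l$ with real coefficients, where $\mathbf{x}=(x_1,\dots,x_m)$ and $\mathbf{y}=(y_1,\dots,y_n)$. A bilinear form is a polynomial $\ell(\mathbf{x},\mathbf{y})=\sum_{i=1}^m\sum_{j=1}^n a_{ij}x_i y_j$ with real coefficients. For a biquadratic form $P$ that is a sum of squares of bilinear forms, the SOS rank $\operatorname{sos}(P)$ is the minimal number $r$ such that $P=\sum_{k=1}^r \ell_k(\mathbf{x},\mathbf{y})^2$ for some bilinear forms $\ell_1,\dots,\ell_r$. *)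

theory Defs
  imports "HOL-Analysis.Analysis"
begin

text \<open>Real forms are represented by the polynomial functions they induce; since the reals are an
  infinite field, two forms are equal as polynomials iff they are equal as functions.\<close>

definition biquadratic_form :: "(real^'m \<Rightarrow> real^'n \<Rightarrow> real) \<Rightarrow> bool" where
  "biquadratic_form P \<longleftrightarrow>
     (\<exists>a :: 'm \<Rightarrow> 'n \<Rightarrow> 'm \<Rightarrow> 'n \<Rightarrow> real. \<forall>x y.
        P x y = (\<Sum>i\<in>UNIV. \<Sum>j\<in>UNIV. \<Sum>k\<in>UNIV. \<Sum>l\<in>UNIV.
                   a i j k l * x$i * x$k * y$j * y$l))"

definition bilinear_form :: "(real^'m \<Rightarrow> real^'n \<Rightarrow> real) \<Rightarrow> bool" where
  "bilinear_form f \<longleftrightarrow>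
     (\<exists>a :: 'm \<Rightarrow> 'n \<Rightarrow> real. \<forall>x y. f x y = (\<Sum>i\<in>UNIV. \<Sum>j\<in>UNIV. a i j * x$i * y$j))"

definition sum_of_bilinear_squares :: "nat \<Rightarrow> (real^'m \<Rightarrow> real^'n \<Rightarrow> real) \<Rightarrow> bool" where
  "sum_of_bilinear_squares r P \<longleftrightarrow>
     (\<exists>f :: nat \<Rightarrow> real^'m \<Rightarrow> real^'n \<Rightarrow> real.
        (\<forall>k<r. bilinear_form (f k)) \<and> (\<forall>x y. P x y = (\<Sum>k<r. (f k x y)\<^sup>2)))"

text \<open>Only meaningful when some such representation of \<open>P\<close> exists; otherwise the value is
  unspecified.\<close>

definition sos_rank :: "(real^'m \<Rightarrow> real^'n \<Rightarrow> real) \<Rightarrow> nat" where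
  "sos_rank P = (LEAST r. sum_of_bilinear_squares r P)"

end

(*
  Write P as the sum of the squares of f 0, ..., f (r - 1), and let v i j be the vector in R^r that
  collects the coefficients of x_i y_j in these forms.  Comparing coefficients determines the sums
  <v i j, v k l> + <v i l, v k j>.  In P this makes v 1 4, v 2 2, v 3 1, v 3 3, v 4 1 and v 5 3
  vanish and the other v i j unit vectors, and it gives <v 2 3, v 5 4> = 1 = <v 4 2, v 5 2>, so
  that v 2 3 = v 5 4 and v 4 2 = v 5 2.  The twelve unit vectors that remain after these
  identifications are pairwise orthogonal, whence r >= 12.
*)
theory Submission
  imports Defs
begin

lemma bilinear_form_monomial: "bilinear_form (\<lambda>x y. x$p * y$q)"
proof -
  \<comment> \<open>The nested \<open>if\<close> lets the inner and the outer sum collapse one after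
    the other.\<close>
  have "x$p * y$q = (\<Sum>i\<in>UNIV. \<Sum>j\<in>UNIV. (if i = p then if j = q then 1 else 0 else 0) * x$i * y$j)"
    for x :: "real^'a" and y :: "real^'b"
  proof -
    have "(\<Sum>j\<in>UNIV. (if i = p then if j = q then 1 else 0 else 0) * x$i * y$j)
        = (if i = p then x$i * y$q else 0)" for i
      by (simp add: if_distrib [of "\<lambda>t. t * _"] cong: if_cong)
    then show ?thesis
      by simp
  qed
  then show ?thesis
    unfolding bilinear_form_def
    by (intro exI [of _ "\<lambda>i j. if i = p then if j = q then 1 else 0 else 0"]) blast
qed

lemma bilinear_form_add:
  assumes "bilinear_form f" and "bilinear_form g"
  shows "bilinear_form (\<lambda>x y. f x y + g x y)"
proof -
  from assms obtain a b where
    "\<And>x y. f x y = (\<Sum>i\<in>UNIV. \<Sum>j\<in>UNIV. a i j * x$i * y$j)"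
    "\<And>x y. g x y = (\<Sum>i\<in>UNIV. \<Sum>j\<in>UNIV. b i j * x$i * y$j)"
    unfolding bilinear_form_def by blast
  then show ?thesis
    unfolding bilinear_form_def
    by (intro exI [of _ "\<lambda>i j. a i j + b i j"]) (simp add: sum.distrib distrib_right)
qed

text \<open>Expanding the squares and moving the sum over the forms innermost shows the coefficients
  of \<open>P\<close>: they are Gram entries.\<close>

lemma sum_of_bilinear_squares_imp_biquadratic_form:
  assumes "sum_of_bilinear_squares r P"
  shows "biquadratic_form P"
proof -
  from assms obtain f where f: "\<And>k. k < r \<Longrightarrow> bilinear_form (f k)"
    and P: "\<And>x y. P x y = (\<Sum>k<r. (f k x y)\<^sup>2)"
    unfolding sum_of_bilinear_squares_def by blast
  from f have "\<forall>k. \<exists>a. k < r \<longrightarrow> (\<forall>x y. f k x y = (\<Sum>i\<in>UNIV. \<Sum>j\<in>UNIV. a i j * x$i * y$j))"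
    unfolding bilinear_form_def by blast
  from choice [OF this] obtain a where
    a: "\<And>k x y. k < r \<Longrightarrow> f k x y = (\<Sum>i\<in>UNIV. \<Sum>j\<in>UNIV. a k i j * x$i * y$j)"
    by blast
  have "P x y = (\<Sum>i\<in>UNIV. \<Sum>j\<in>UNIV. \<Sum>k\<in>UNIV. \<Sum>l\<in>UNIV.
      (\<Sum>m<r. a m i j * a m k l) * x$i * x$k * y$j * y$l)" for x y
  proof -
    have "P x y = (\<Sum>m<r. (\<Sum>i\<in>UNIV. \<Sum>j\<in>UNIV. a m i j * x$i * y$j)\<^sup>2)"
      by (simp add: P a)
    also have "\<dots> = (\<Sum>m<r. \<Sum>i\<in>UNIV. \<Sum>j\<in>UNIV. \<Sum>k\<in>UNIV. \<Sum>l\<in>UNIV.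
        a m i j * a m k l * x$i * x$k * y$j * y$l)"
      unfolding power2_eq_square sum_distrib_right unfolding sum_distrib_left
      by (intro sum.cong refl) (simp only: mult_ac)
    also have "\<dots> = (\<Sum>i\<in>UNIV. \<Sum>j\<in>UNIV. \<Sum>k\<in>UNIV. \<Sum>l\<in>UNIV. \<Sum>m<r.
        a m i j * a m k l * x$i * x$k * y$j * y$l)"
      by (simp only: sum.swap [of _ _ "{..<r}"])
    finally show ?thesis
      by (simp add: sum_distrib_right)
  qed
  then show ?thesis
    unfolding biquadratic_form_def
    by (intro exI [of _ "\<lambda>i j k l. \<Sum>m<r. a m i j * a m k l"]) blast
qed

lemma bilinear_form_imp_bilinear:
  assumes "bilinear_form f"
  shows "bilinear f"
proof -
  from assms obtain a where "\<And>x y. f x y = (\<Sum>i\<in>UNIV. \<Sum>j\<in>UNIV. a i j * x$i * y$j)"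
    unfolding bilinear_form_def by blast
  then have "f = (\<lambda>x y. \<Sum>i\<in>UNIV. \<Sum>j\<in>UNIV. a i j * x$i * y$j)"
    by blast
  then show ?thesis
    by (auto simp: bilinear_def linear_iff sum.distrib sum_distrib_left algebra_simps)
qed

text \<open>Bessel's inequality for the \<open>k\<close>-th standard basis vector of R^r. Its
  projection to the span of the \<open>v i\<close> is \<open>w\<close>, so |w|^2 =
  \<open>w k\<close>; then (\<open>w k\<close>)^2 <= |w|^2 forces \<open>w k\<close> <= 1.\<close>

lemma sum_square_le_1_if_orthonormal:
  fixes v :: "'i \<Rightarrow> nat \<Rightarrow> real"
  assumes "finite I" and "k < r"
    and orth: "\<And>i j. i \<in> I \<Longrightarrow> j \<in> I \<Longrightarrow> (\<Sum>k<r. v i k * v j k) = (if i = j then 1 else 0)"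
  shows "(\<Sum>i\<in>I. (v i k)\<^sup>2) \<le> 1"
proof -
  define w where "w l = (\<Sum>i\<in>I. v i k * v i l)" for l
  have wk: "w k = (\<Sum>i\<in>I. (v i k)\<^sup>2)"
    by (simp add: w_def power2_eq_square)
  have "(\<Sum>l<r. (w l)\<^sup>2) = (\<Sum>l<r. \<Sum>i\<in>I. \<Sum>j\<in>I. v i k * v j k * (v i l * v j l))"
    by (simp add: w_def power2_eq_square sum_product mult_ac)
  also have "\<dots> = (\<Sum>i\<in>I. \<Sum>j\<in>I. \<Sum>l<r. v i k * v j k * (v i l * v j l))"
    by (simp only: sum.swap [of _ _ "{..<r}"])
  also have "\<dots> = (\<Sum>i\<in>I. \<Sum>j\<in>I. v i k * v j k * (if i = j then 1 else 0))"
    by (simp only: sum_distrib_left [symmetric] orth cong: sum.cong)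
  also have "\<dots> = w k"
    using \<open>finite I\<close> by (simp add: wk power2_eq_square if_distrib [of "\<lambda>t. _ * t"] cong: if_cong)
  finally have "(\<Sum>l<r. (w l)\<^sup>2) = w k" .
  moreover have "(w k)\<^sup>2 \<le> (\<Sum>l<r. (w l)\<^sup>2)"
    using \<open>k < r\<close> by (intro member_le_sum) auto
  ultimately have "(w k)\<^sup>2 \<le> w k"
    by simp
  then have "w k \<le> 1"
    by (cases "w k \<le> 0") (auto simp: power2_eq_square)
  then show ?thesis
    by (simp add: wk)
qed

text \<open>Double counting of the squared entries: each vector contributes 1, each of the
  \<open>r\<close> coordinates at most 1.\<close>

lemma card_le_if_orthonormal:
  fixes v :: "'i \<Rightarrow> nat \<Rightarrow> real"
  assumes "finite I"
    and orth: "\<And>i j. i \<in> I \<Longrightarrow> j \<in> I \<Longrightarrow> (\<Sum>k<r. v i k * v j k) = (if i = j then 1 else 0)"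
  shows "card I \<le> r"
proof -
  have "real (card I) = (\<Sum>i\<in>I. \<Sum>k<r. (v i k)\<^sup>2)"
    by (simp add: power2_eq_square orth)
  also have "\<dots> = (\<Sum>k<r. \<Sum>i\<in>I. (v i k)\<^sup>2)"
    by (rule sum.swap)
  also have "\<dots> \<le> (\<Sum>k<r. 1)"
    using assms by (intro sum_mono sum_square_le_1_if_orthonormal) auto
  finally show ?thesis
    by simp
qed

text \<open>With a list, \<open>sorted_wrt\<close> tests each pair of positions once, which suits an
  explicit family.\<close>

lemma length_le_if_orthonormal:
  fixes vs :: "(nat \<Rightarrow> real) list"
  assumes unit: "list_all (\<lambda>u. (\<Sum>k<r. u k * u k) = 1) vs"
    and orth: "sorted_wrt (\<lambda>u w. (\<Sum>k<r. u k * w k) = 0) vs"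
  shows "length vs \<le> r"
proof -
  have "(\<Sum>k<r. (vs ! i) k * (vs ! j) k) = (if i = j then 1 else 0)"
    if "i < length vs" "j < length vs" for i j
    using sorted_wrt_nth_less [OF orth, of i j] sorted_wrt_nth_less [OF orth, of j i] that
    by (cases i j rule: linorder_cases) (use unit in \<open>auto simp: list_all_length mult.commute\<close>)
  then have "card {..<length vs} \<le> r"
    by (intro card_le_if_orthonormal [where v = "\<lambda>i. vs ! i"]) auto
  then show ?thesis
    by simp
qed

text \<open>The alternating sum on the right is the polarisation of \<open>P\<close> in both arguments. At unit vectors
  it isolates the coefficient of a monomial \<open>x\<^sub>i x\<^sub>k y\<^sub>j y\<^sub>l\<close> of \<open>P\<close>.\<close>

lemma Gram_relation:
  assumes f: "\<And>m. m < r \<Longrightarrow> bilinear (f m)"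
    and P: "\<And>x y. P x y = (\<Sum>m<r. (f m x y)\<^sup>2 :: real)"
  shows "2 * ((\<Sum>m<r. f m x y * f m x' y') + (\<Sum>m<r. f m x y' * f m x' y)) =
      P (x + x') (y + y') - P (x + x') y - P (x + x') y' - P x (y + y') - P x' (y + y')
    + P x y + P x y' + P x' y + P x' y'"
proof -
  \<comment> \<open>Bilinearity turns this into a polynomial identity in the four values of
    \<open>f m\<close> at \<open>x\<close> or \<open>x'\<close> and \<open>y\<close> or
    \<open>y'\<close>.\<close>
  have "2 * (f m x y * f m x' y' + f m x y' * f m x' y) =
      (f m (x + x') (y + y'))\<^sup>2 - (f m (x + x') y)\<^sup>2 - (f m (x + x') y')\<^sup>2
    - (f m x (y + y'))\<^sup>2 - (f m x' (y + y'))\<^sup>2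
    + (f m x y)\<^sup>2 + (f m x y')\<^sup>2 + (f m x' y)\<^sup>2 + (f m x' y')\<^sup>2" if "m < r" for m
    unfolding bilinear_ladd [OF f [OF that]] bilinear_radd [OF f [OF that]]
    by (simp add: power2_eq_square algebra_simps)
  then show ?thesis
    unfolding P by (simp flip: sum.distrib sum_subtractf add: sum_distrib_left)
qed

lemma sum_of_bilinear_squares_lower_bound:
  fixes P :: "real^5 \<Rightarrow> real^4 \<Rightarrow> real"
  assumes P_eq: "\<And>x y. P x y =
      (x$1)\<^sup>2 * (y$1)\<^sup>2 + (x$1)\<^sup>2 * (y$2)\<^sup>2 + (x$1)\<^sup>2 * (y$3)\<^sup>2
    + (x$2)\<^sup>2 * (y$1)\<^sup>2 + (x$2)\<^sup>2 * (y$4)\<^sup>2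
    + (x$3)\<^sup>2 * (y$2)\<^sup>2 + (x$3)\<^sup>2 * (y$4)\<^sup>2
    + (x$4)\<^sup>2 * (y$3)\<^sup>2 + (x$4)\<^sup>2 * (y$4)\<^sup>2
    + (x$5)\<^sup>2 * (y$1)\<^sup>2
    + (x$2 * y$3 + x$5 * y$4)\<^sup>2
    + (x$4 + x$5)\<^sup>2 * (y$2)\<^sup>2"
    and sos: "sum_of_bilinear_squares r P"
  shows "12 \<le> r"
proof -
  from sos obtain f where f: "\<And>m. m < r \<Longrightarrow> bilinear (f m)"
    and P: "\<And>x y. P x y = (\<Sum>m<r. (f m x y)\<^sup>2)"
    unfolding sum_of_bilinear_squares_def using bilinear_form_imp_bilinear by blast
  \<comment> \<open>Vectors of R^r are functions on \<open>nat\<close> of which only the first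
    \<open>r\<close> entries count.\<close>
  define ip where "ip u w = (\<Sum>m<r. u m * w m)" for u w :: "nat \<Rightarrow> real"
  define e :: "5 \<Rightarrow> real^5" where "e i = axis i 1" for i
  define d :: "4 \<Rightarrow> real^4" where "d j = axis j 1" for j
  define v where "v i j m = f m (e i) (d j)" for i j m
  have e_nth [simp]: "e i $ k = (if k = i then 1 else 0)" for i k
    by (auto simp: e_def axis_def)
  have d_nth [simp]: "d j $ l = (if l = j then 1 else 0)" for j l
    by (auto simp: d_def axis_def)
  \<comment> \<open>The coordinates of \<open>e\<close> and \<open>d\<close> stay symbolic, so that
    whole groups of terms can be cancelled for general indices instead of checking every
    quadruple.\<close>
  have gram: "ip (v i j) (v k l) + ip (v i l) (v k j) =
      2 * (e i $ 1 * e k $ 1 * (d j $ 1 * d l $ 1 + d j $ 2 * d l $ 2 + d j $ 3 * d l $ 3)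
        + e i $ 2 * e k $ 2 * (d j $ 1 * d l $ 1 + d j $ 3 * d l $ 3 + d j $ 4 * d l $ 4)
        + e i $ 3 * e k $ 3 * (d j $ 2 * d l $ 2 + d j $ 4 * d l $ 4)
        + e i $ 4 * e k $ 4 * (d j $ 2 * d l $ 2 + d j $ 3 * d l $ 3 + d j $ 4 * d l $ 4)
        + e i $ 5 * e k $ 5 * (d j $ 1 * d l $ 1 + d j $ 2 * d l $ 2 + d j $ 4 * d l $ 4)
        + (e i $ 4 * e k $ 5 + e i $ 5 * e k $ 4) * (d j $ 2 * d l $ 2))
      + (e i $ 2 * e k $ 5 + e i $ 5 * e k $ 2) * (d j $ 3 * d l $ 4 + d j $ 4 * d l $ 3)"
    for i j k l
  proof -
    have "2 * (ip (v i j) (v k l) + ip (v i l) (v k j)) =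
        P (e i + e k) (d j + d l) - P (e i + e k) (d j) - P (e i + e k) (d l)
      - P (e i) (d j + d l) - P (e k) (d j + d l)
      + P (e i) (d j) + P (e i) (d l) + P (e k) (d j) + P (e k) (d l)"
      unfolding ip_def v_def by (rule Gram_relation [OF f P])
    then show ?thesis
      unfolding P_eq vector_add_component by algebra
  qed

  have ip_commute: "ip u w = ip w u" for u w
    by (simp add: ip_def mult.commute)
  have ip_cong: "ip u w = ip u' w" if "\<And>m. m < r \<Longrightarrow> u m = u' m" for u u' w
    using that by (simp add: ip_def)
  have vanish: "ip u w = 0" "ip w u = 0" if "ip u u = 0" for u w
  proof -
    from that have "u m = 0" if "m < r" for m
      using that by (simp add: ip_def sum_nonneg_eq_0_iff)
    then show "ip u w = 0" "ip w u = 0"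
      by (simp_all add: ip_def)
  qed
  \<comment> \<open>Here |u - u'|^2 = 1 - 2 + 1 = 0. The vectors agree only below \<open>r\<close>,
    hence the conclusion about \<open>ip\<close> rather than \<open>u = u'\<close>.\<close>
  have coincide: "ip u w = ip u' w" if "ip u u = 1" "ip u' u' = 1" "ip u u' = 1" for u u' w
  proof (rule ip_cong)
    fix m assume "m < r"
    have "(\<Sum>m<r. (u m - u' m)\<^sup>2) = ip u u - 2 * ip u u' + ip u' u'"
      by (simp add: ip_def power2_eq_square algebra_simps sum.distrib sum_subtractf sum_distrib_left)
    with that have "(\<Sum>m<r. (u m - u' m)\<^sup>2) = 0"
      by simp
    with \<open>m < r\<close> show "u m = u' m"
      by (simp add: sum_nonneg_eq_0_iff)
  qed

  have null [simp]: "ip (v i j) (v i j) = 0"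
    if "(i, j) \<in> {(1, 4), (2, 2), (3, 1), (3, 3), (4, 1), (5, 3)}" for i j
    using gram [of i j i j] that by auto
  have unit [simp]: "ip (v i j) (v i j) = 1"
    if "(i, j) \<in> {(1, 1), (1, 2), (1, 3), (2, 1), (2, 3), (2, 4), (3, 2), (3, 4),
      (4, 2), (4, 3), (4, 4), (5, 1), (5, 2), (5, 4)}" for i j
    using gram [of i j i j] that by auto
  have e_0: "e i $ p * e k $ q = 0" if "i = k \<and> p \<noteq> q \<or> i \<noteq> k \<and> p = q" for i k p q
    using that by auto
  have d_0: "d j $ p * d l $ q = 0" if "j = l \<and> p \<noteq> q \<or> j \<noteq> l \<and> p = q" for j l p q
    using that by auto
  have e_mixed: "e i $ p * e k $ q + e i $ q * e k $ p = 0" if "{i, k} \<noteq> {p, q}" for i k p q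
    using that by auto
  have d_mixed: "d j $ p * d l $ q + d j $ q * d l $ p = 0" if "{j, l} \<noteq> {p, q}" for j l p q
    using that by auto
  \<comment> \<open>\<open>P\<close> has no monomial x_i^2 y_j y_l with j \<noteq> l. Among the x_i
    x_k y_j^2 with i \<noteq> k only x_4 x_5 y_2^2 occurs, whence the exception in
    \<open>column\<close>.\<close>
  have row [simp]: "ip (v i j) (v i l) = 0" if "j \<noteq> l" for i j l
    using gram [of i j i l] that by (simp add: e_0 d_0 ip_commute [of "v i l"] del: e_nth d_nth)
  have column [simp]: "ip (v i j) (v k j) = 0"
    if "i \<noteq> k" "j \<noteq> 2 \<or> {i, k} \<noteq> {4, 5}" for i j k
  proof -
    have "(e i $ 4 * e k $ 5 + e i $ 5 * e k $ 4) * (d j $ 2 * d j $ 2) = 0"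
      using that e_mixed [of i k 4 5] by auto
    with gram [of i j k j] that show ?thesis
      by (simp add: e_0 d_0 ip_commute [of "v k j"] del: e_nth d_nth mult_eq_0_iff)
  qed
  \<comment> \<open>Away from x_2 x_5 y_3 y_4 the two products sum to 0, so orthogonality passes
    from one diagonal of a 2 x 2 block of indices to the other.\<close>
  have cross: "ip (v i j) (v k l) = 0"
    if "i \<noteq> k" "j \<noteq> l" "{i, k} \<noteq> {2, 5} \<or> {j, l} \<noteq> {3, 4}" "ip (v i l) (v k j) = 0" for i j k l
  proof -
    have "(e i $ 2 * e k $ 5 + e i $ 5 * e k $ 2) * (d j $ 3 * d l $ 4 + d j $ 4 * d l $ 3) = 0"
      unfolding mult_eq_0_iff using that(3) e_mixed [of i k 2 5] d_mixed [of j l 3 4] by blast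
    with gram [of i j k l] that(1,2,4) show ?thesis
      by (simp add: e_0 d_0 del: e_nth d_nth mult_eq_0_iff)
  qed
  \<comment> \<open>As a simp rule \<open>cross\<close> would swap diagonals forever; this version
    asks for a null vector on the other diagonal, which \<open>null\<close> and \<open>unit\<close>
    decide.\<close>
  have cross' [simp]: "ip (v i j) (v k l) = 0"
    if "i \<noteq> k" "j \<noteq> l" "{i, k} \<noteq> {2, 5} \<or> {j, l} \<noteq> {3, 4}"
      "ip (v i l) (v i l) = 0 \<or> ip (v k j) (v k j) = 0" for i j k l
    by (rule cross [OF that(1-3)]) (use that(4) vanish in blast)

  note doubleton_eq_iff [simp]
  \<comment> \<open>The first product comes from 2 x_2 x_5 y_3 y_4, where the other diagonal
    contains the null vector \<open>v 5 3\<close>; the second from 2 x_4 x_5 y_2^2.\<close>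
  have "ip (v 2 3) (v 5 4) = 1" "ip (v 4 2) (v 5 2) = 1"
    using gram [of 2 3 5 4] gram [of 4 2 5 2] vanish [OF null, of 5 3] by simp_all
  then have same: "ip w (v 2 3) = ip w (v 5 4)" "ip w (v 4 2) = ip w (v 5 2)" for w
    using coincide [of "v 2 3" "v 5 4" w] coincide [of "v 4 2" "v 5 2" w]
    by (simp_all add: ip_commute [of w])

  have orth_23 [simp]: "ip (v 1 1) (v 2 3) = 0" "ip (v 1 2) (v 2 3) = 0" "ip (v 3 4) (v 2 3) = 0"
      "ip (v 4 4) (v 2 3) = 0" "ip (v 5 1) (v 2 3) = 0"
    by (simp_all add: same(1))
  \<comment> \<open>Read as \<open>v 2 3\<close>, the vector \<open>v 5 4\<close> meets a null
    vector across the diagonal. Swapping diagonals then reaches \<open>v 5 2\<close>, that is,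
    \<open>v 4 2\<close>.\<close>
  have "ip (v 3 2) (v 5 4) = 0"
    by (simp flip: same(1))
  then have "ip (v 3 4) (v 5 2) = 0"
    by (simp add: cross [of 3 5 4 2])
  then have orth_42 [simp]: "ip (v 1 3) (v 4 2) = 0" "ip (v 3 4) (v 4 2) = 0" "ip (v 5 1) (v 4 2) = 0"
    by (simp_all add: same(2))
  \<comment> \<open>These are opposite diagonals for some of the six pairs below, whose opposite
    diagonals contain no null vector.\<close>
  have "ip (v 1 1) (v 5 2) = 0" "ip (v 2 1) (v 5 4) = 0"
    by (simp_all flip: same)
  note crossed = this orth_23(4) [unfolded ip_commute [of "v 4 4"]]
  have [simp]: "ip (v 1 2) (v 4 3) = 0"
    by (rule cross) simp_all
  have [simp]: "ip (v 1 2) (v 5 1) = 0"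
    by (rule cross) (simp_all add: crossed)
  have [simp]: "ip (v 1 3) (v 2 1) = 0"
    by (rule cross) simp_all
  have [simp]: "ip (v 2 4) (v 4 3) = 0"
    by (rule cross) (simp_all add: crossed)
  have [simp]: "ip (v 2 4) (v 5 1) = 0"
    by (rule cross) (simp_all add: crossed)
  have [simp]: "ip (v 3 2) (v 4 4) = 0"
    by (rule cross) simp_all
  \<comment> \<open>Of each identified pair one vector is kept. \<open>v 2 3\<close> and
    \<open>v 4 2\<close> stand last, so that they are second arguments as in \<open>orth_23\<close>
    and \<open>orth_42\<close>.\<close>
  let ?vs = "[v 1 1, v 1 2, v 1 3, v 2 1, v 2 4, v 3 2, v 3 4, v 4 3, v 4 4, v 5 1, v 2 3, v 4 2]"
  have "list_all (\<lambda>u. ip u u = 1) ?vs"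
    by simp
  moreover have "sorted_wrt (\<lambda>u w. ip u w = 0) ?vs"
    by simp
  ultimately have "length ?vs \<le> r"
    unfolding ip_def by (rule length_le_if_orthonormal)
  then show ?thesis
    by simp
qed

theorem theorem2p2:
  fixes P :: "real^5 \<Rightarrow> real^4 \<Rightarrow> real"
  assumes P_eq: "\<And>x y. P x y =
      (x$1)\<^sup>2 * (y$1)\<^sup>2 + (x$1)\<^sup>2 * (y$2)\<^sup>2 + (x$1)\<^sup>2 * (y$3)\<^sup>2
    + (x$2)\<^sup>2 * (y$1)\<^sup>2 + (x$2)\<^sup>2 * (y$4)\<^sup>2
    + (x$3)\<^sup>2 * (y$2)\<^sup>2 + (x$3)\<^sup>2 * (y$4)\<^sup>2
    + (x$4)\<^sup>2 * (y$3)\<^sup>2 + (x$4)\<^sup>2 * (y$4)\<^sup>2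
    + (x$5)\<^sup>2 * (y$1)\<^sup>2
    + (x$2 * y$3 + x$5 * y$4)\<^sup>2
    + (x$4 + x$5)\<^sup>2 * (y$2)\<^sup>2"
  shows "biquadratic_form P \<and> (\<exists>r. sum_of_bilinear_squares r P) \<and> sos_rank P = 12"
proof -
  \<comment> \<open>The twelve squares displayed in \<open>P\<close> give the upper bound and make
    the \<open>LEAST\<close> in \<open>sos_rank\<close> meaningful.\<close>
  define fs :: "(real^5 \<Rightarrow> real^4 \<Rightarrow> real) list" where
    "fs = [\<lambda>x y. x$1 * y$1, \<lambda>x y. x$1 * y$2, \<lambda>x y. x$1 * y$3, \<lambda>x y. x$2 * y$1,
      \<lambda>x y. x$2 * y$4, \<lambda>x y. x$3 * y$2, \<lambda>x y. x$3 * y$4, \<lambda>x y. x$4 * y$3,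
      \<lambda>x y. x$4 * y$4, \<lambda>x y. x$5 * y$1, \<lambda>x y. x$2 * y$3 + x$5 * y$4,
      \<lambda>x y. x$4 * y$2 + x$5 * y$2]"
  have "\<forall>f\<in>set fs. bilinear_form f"
    by (simp add: fs_def bilinear_form_monomial bilinear_form_add)
  moreover have "length fs = 12"
    by (simp add: fs_def)
  ultimately have "bilinear_form (fs ! k)" if "k < 12" for k
    using that by simp
  moreover have "P x y = (\<Sum>k<12. ((fs ! k) x y)\<^sup>2)" for x y
    by (simp add: P_eq fs_def numeral_eq_Suc power_mult_distrib distrib_right [symmetric])
  ultimately have sos: "sum_of_bilinear_squares 12 P"
    unfolding sum_of_bilinear_squares_def by blast
  moreover have "sos_rank P = 12"
    unfolding sos_rank_def
    using sos sum_of_bilinear_squares_lower_bound [OF P_eq] by (rule Least_equality)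
  ultimately show ?thesis
    using sum_of_bilinear_squares_imp_biquadratic_form by blast
qed

end
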